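(* Under the setting and assumptions in the context, at the Nash equilibrium of the power allocation game, $G^*_k(t)=G_k^{\mathrm{total}}/T$, and at the Stackelberg equilibrium of the price and demand selection game, the optimal prices $$p_k^*(t)=\frac{B}{G^*_k(t)+N}\left(\frac{1}{KT-\sum_{j\in\mathcal{K}}\sum_{h\in\mathcal{T}}\frac{N}{G^*_j(h)+N}}\right),\qquad B=\sum_{n\in\mathcal{N}}B_n,$$ satisfy $$p_k^*(t)\le p^{\max},\qquad \sum_{k\in\mathcal{K}}\pi_k(\mathbf{p}^*_k,\mathbf{p}^*_{-k})=\sum_{n\in\mathcal{N}}B_n,$$ if, and only if, $$\frac{K}{N}\ \ge\ \frac{B_n}{p^{\max}\,T\,G_k^*(t)},$$ for each $t\in\mathcal{T}$ and $k\in\mathcal{K}$.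
   Context: $\mathcal{K}=\{1,\dots,K\}$ is the set of companies, $\mathcal{N}=\{1,\dots,N\}$ the set of consumers, $\mathcal{T}=\{1,\dots,T\}$ the set of time slots; $p^{\max}>0$ is a given maximum allowable market price. Assumptions: (1) each consumer's budget satisfies $B_n\ge \frac{E_n^{\min}+KT}{\sum_{k,t}\frac{1}{KTp_k(t)}}-\sum_{k,t}p_k(t)$ for the announced prices, where $E_n^{\min}\ge 0$ is the minimum energy need of consumer $n$; (2) the utility parameters are $\gamma_n=\zeta_n=1$ (utility $\sum_{k,t}\ln(1+d_{n,k}(t))$); (3) the total power $G_k^{\mathrm{total}}>0$ available over the horizon is the same for each company $k$; (4) the budget $B_n>0$ is the same for every consumer $n$. At the Nash equilibrium of the power allocation game each company splits its total power equally over time: $G_k^*(t)=G_k^{\mathrm{total}}/T$. At the Stackelberg equilibrium the power availabilities are $G^*_k(t)$, the prices are $p_k^*(t)$, and the demands are $$d^*_{n,k}(t)=\frac{B_n+\sum_{j\in\mathcal{K}}\sum_{h\in\mathcal{T}}p^*_j(h)}{KT\,p^*_k(t)}-1 .$$ The revenue of company $k$ is $\pi_k(\mathbf{p}^*_k,\mathbf{p}^*_{-k})=\sum_{t\in\mathcal{T}}p_k^*(t)\sum_{n\in\mathcal{N}}d^*_{n,k}(t)$. *)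

theory Defs
  imports Complex_Main
begin

text \<open>
  Companies, time slots and consumers are the index sets \<open>{1..K}\<close>, \<open>{1..T}\<close> and \<open>{1..N}\<close>.
  Prices \<open>p k t\<close>, power availabilities \<open>G k t\<close> and demands \<open>d n k t\<close> are total functions of
  which only the values on these index sets are ever used.
\<close>

definition sum_slots :: "nat \<Rightarrow> nat \<Rightarrow> (nat \<Rightarrow> nat \<Rightarrow> real) \<Rightarrow> real" where
  "sum_slots K T f = (\<Sum>k\<in>{1..K}. \<Sum>t\<in>{1..T}. f k t)"

subsection \<open>Price and demand selection game\<close>

definition consumer_feasible ::
  "nat \<Rightarrow> nat \<Rightarrow> real \<Rightarrow> real \<Rightarrow> (nat \<Rightarrow> nat \<Rightarrow> real) \<Rightarrow> (nat \<Rightarrow> nat \<Rightarrow> real) \<Rightarrow> bool" where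
  "consumer_feasible K T b e p x \<longleftrightarrow>
     (\<forall>k\<in>{1..K}. \<forall>t\<in>{1..T}. 0 \<le> x k t) \<and>
     sum_slots K T (\<lambda>k t. p k t * x k t) \<le> b \<and>
     e \<le> sum_slots K T x"

definition utility :: "nat \<Rightarrow> nat \<Rightarrow> (nat \<Rightarrow> nat \<Rightarrow> real) \<Rightarrow> real" where
  "utility K T x = sum_slots K T (\<lambda>k t. ln (1 + x k t))"

definition consumer_optimal ::
  "nat \<Rightarrow> nat \<Rightarrow> real \<Rightarrow> real \<Rightarrow> (nat \<Rightarrow> nat \<Rightarrow> real) \<Rightarrow> (nat \<Rightarrow> nat \<Rightarrow> real) \<Rightarrow> bool" where
  "consumer_optimal K T b e p x \<longleftrightarrow>
     consumer_feasible K T b e p x \<and>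
     (\<forall>y. consumer_feasible K T b e p y \<longrightarrow> utility K T y \<le> utility K T x)"

definition revenue ::
  "nat \<Rightarrow> nat \<Rightarrow> (nat \<Rightarrow> nat \<Rightarrow> real) \<Rightarrow> (nat \<Rightarrow> nat \<Rightarrow> nat \<Rightarrow> real) \<Rightarrow> nat \<Rightarrow> real" where
  "revenue T N p d k = (\<Sum>t\<in>{1..T}. p k t * (\<Sum>n\<in>{1..N}. d n k t))"

definition company_feasible ::
  "nat \<Rightarrow> nat \<Rightarrow> (nat \<Rightarrow> nat \<Rightarrow> real) \<Rightarrow> (nat \<Rightarrow> nat \<Rightarrow> real) \<Rightarrow>
   (nat \<Rightarrow> nat \<Rightarrow> nat \<Rightarrow> real) \<Rightarrow> nat \<Rightarrow> bool" where
  "company_feasible T N G p d k \<longleftrightarrow>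
     (\<forall>t\<in>{1..T}. 0 < p k t \<and> (\<Sum>n\<in>{1..N}. d n k t) \<le> G k t)"

text \<open>
  Leaders (companies) play Nash in prices, anticipating the followers' (consumers') optimal
  response to any deviation. The maximum market price is deliberately not a constraint of the
  game. A price deviation at which some consumer's problem has no solution (for instance because
  the minimum energy need is not affordable) is not available to a company.
\<close>

definition stackelberg_equilibrium ::
  "nat \<Rightarrow> nat \<Rightarrow> nat \<Rightarrow> (nat \<Rightarrow> real) \<Rightarrow> (nat \<Rightarrow> real) \<Rightarrow> (nat \<Rightarrow> nat \<Rightarrow> real) \<Rightarrow>
   (nat \<Rightarrow> nat \<Rightarrow> real) \<Rightarrow> (nat \<Rightarrow> nat \<Rightarrow> nat \<Rightarrow> real) \<Rightarrow> bool" where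
  "stackelberg_equilibrium K T N B E G p d \<longleftrightarrow>
     (\<forall>n\<in>{1..N}. consumer_optimal K T (B n) (E n) p (d n)) \<and>
     (\<forall>k\<in>{1..K}. company_feasible T N G p d k) \<and>
     (\<forall>k\<in>{1..K}. \<forall>q d'.
        (\<forall>n\<in>{1..N}. consumer_optimal K T (B n) (E n) (p(k := q)) (d' n)) \<and>
        company_feasible T N G (p(k := q)) d' k \<longrightarrow>
        revenue T N (p(k := q)) d' k \<le> revenue T N p d k)"

subsection \<open>Power allocation game\<close>

text \<open>The closed-form equilibrium prices and demands, as functions of the availabilities and of
  the prices, respectively.\<close>

definition price_star ::
  "nat \<Rightarrow> nat \<Rightarrow> nat \<Rightarrow> (nat \<Rightarrow> real) \<Rightarrow> (nat \<Rightarrow> nat \<Rightarrow> real) \<Rightarrow> nat \<Rightarrow> nat \<Rightarrow> real" where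
  "price_star K T N B G k t =
     (\<Sum>n\<in>{1..N}. B n) / (G k t + real N) *
     (1 / (real K * real T - sum_slots K T (\<lambda>j h. real N / (G j h + real N))))"

definition demand_star ::
  "nat \<Rightarrow> nat \<Rightarrow> (nat \<Rightarrow> real) \<Rightarrow> (nat \<Rightarrow> nat \<Rightarrow> real) \<Rightarrow> nat \<Rightarrow> nat \<Rightarrow> nat \<Rightarrow> real" where
  "demand_star K T B p n k t =
     (B n + sum_slots K T p) / (real K * real T * p k t) - 1"

definition allocation_payoff ::
  "nat \<Rightarrow> nat \<Rightarrow> nat \<Rightarrow> (nat \<Rightarrow> real) \<Rightarrow> (nat \<Rightarrow> nat \<Rightarrow> real) \<Rightarrow> nat \<Rightarrow> real" where
  "allocation_payoff K T N B G k =
     revenue T N (price_star K T N B G) (demand_star K T B (price_star K T N B G)) k"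

definition allocation_feasible :: "nat \<Rightarrow> real \<Rightarrow> (nat \<Rightarrow> real) \<Rightarrow> bool" where
  "allocation_feasible T gtot g \<longleftrightarrow> (\<forall>t\<in>{1..T}. 0 \<le> g t) \<and> (\<Sum>t\<in>{1..T}. g t) \<le> gtot"

text \<open>
  The only profile at which the price formula divides by zero is the one where no company
  offers any power; the convention \<open>x / 0 = 0\<close> then gives every company payoff \<open>0\<close>.
\<close>

definition power_allocation_nash ::
  "nat \<Rightarrow> nat \<Rightarrow> nat \<Rightarrow> (nat \<Rightarrow> real) \<Rightarrow> (nat \<Rightarrow> real) \<Rightarrow> (nat \<Rightarrow> nat \<Rightarrow> real) \<Rightarrow> bool" where
  "power_allocation_nash K T N B Gtot G \<longleftrightarrow>
     (\<forall>k\<in>{1..K}. allocation_feasible T (Gtot k) (G k)) \<and>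
     (\<forall>k\<in>{1..K}. \<forall>g. allocation_feasible T (Gtot k) g \<longrightarrow>
        allocation_payoff K T N B (G(k := g)) k \<le> allocation_payoff K T N B G k)"

end

theory Submission
  imports Defs
begin

text \<open>
  With equal budgets \<open>b\<close> and equal availabilities \<open>g\<close> per company and slot, the closed form
  gives one and the same price \<open>P = N b / (K T g)\<close> in every slot and demand \<open>g / N\<close> for every
  consumer.  Each company thus sells everything it has, the consumers spend their whole budgets,
  and the revenue identity holds automatically; the stated condition is \<open>P \<le> pmax\<close> rewritten.
  The substance lies in the two equilibrium claims.

  \<^emph>\<open>Power allocation.\<close>  Under the closed-form prices and demands the total budget is shared among
  the companies in proportion to \<open>\<Sum>\<^sub>t G\<^sub>k(t) / (G\<^sub>k(t) + N)\<close> (\<open>allocation_payoff_share\<close>).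
  Hence a company wants to maximise its own such sum, and since \<open>x / (x + N)\<close> is concave, the equal
  split does so (\<open>market_weight_le_equal_split\<close>).

  \<^emph>\<open>Prices and demands.\<close>  That the closed-form demand is a consumer's best response follows from
  concavity of the logarithm (\<open>demand_star_optimal\<close>); the lower bound on the budget is precisely
  the statement that this demand meets the energy need (\<open>demand_star_energy\<close>).  For a price
  deviation of company \<open>k\<close>, no formula for the consumers' responses is available, because energy
  needs may bind and some demands may vanish.  An exchange argument replaces it: an optimal consumer
  never spends more in a dearer slot than in a cheaper one, since otherwise exchanging the two
  expenditures would raise both utility and energy (\<open>optimal_spending_antimono\<close>).  Now let \<open>Y\<close> be the
  average, over the slots of the other companies, of total demand.  A slot of company \<open>k\<close> priced at
  most \<open>P\<close> earns at most \<open>P g\<close> by the capacity constraint, and one priced above \<open>P\<close> earns at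
  most \<open>P Y\<close> by the exchange argument.  If \<open>Y \<le> g\<close>, company \<open>k\<close> earns at most \<open>T P g\<close>; if
  \<open>Y \<ge> g\<close>, the others already collect at least their equilibrium revenues and the budgets leave at
  most \<open>T P g\<close> to company \<open>k\<close> (\<open>price_deviation_revenue_le\<close>).  A single company is bounded by the
  budgets alone.
\<close>

section \<open>Sums over all slots\<close>

lemma sum_slots_Times:
  "sum_slots K T f = (\<Sum>z\<in>{1..K} \<times> {1..T}. f (fst z) (snd z))"
  unfolding sum_slots_def by (subst sum.cartesian_product) (simp add: case_prod_unfold)

lemma sum_slots_cong:
  assumes "\<And>k t. k \<in> {1..K} \<Longrightarrow> t \<in> {1..T} \<Longrightarrow> f k t = g k t"
  shows "sum_slots K T f = sum_slots K T g"
  unfolding sum_slots_def by (intro sum.cong refl assms)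

lemma sum_slots_mono:
  assumes "\<And>k t. k \<in> {1..K} \<Longrightarrow> t \<in> {1..T} \<Longrightarrow> f k t \<le> g k t"
  shows "sum_slots K T f \<le> sum_slots K T g"
  unfolding sum_slots_def by (intro sum_mono assms)

lemma sum_slots_const: "sum_slots K T (\<lambda>k t. c) = real K * real T * c"
  unfolding sum_slots_def by simp

lemma sum_slots_add: "sum_slots K T (\<lambda>k t. f k t + g k t) = sum_slots K T f + sum_slots K T g"
  unfolding sum_slots_def by (simp add: sum.distrib)

lemma sum_slots_diff: "sum_slots K T (\<lambda>k t. f k t - g k t) = sum_slots K T f - sum_slots K T g"
  unfolding sum_slots_def by (simp add: sum_subtractf)

lemma sum_slots_mult: "sum_slots K T (\<lambda>k t. c * f k t) = c * sum_slots K T f"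
  unfolding sum_slots_def by (simp add: sum_distrib_left)

lemma sum_slots_pos:
  assumes "K \<ge> 1" "T \<ge> 1"
    and "\<And>k t. k \<in> {1..K} \<Longrightarrow> t \<in> {1..T} \<Longrightarrow> 0 < f k t"
  shows "0 < sum_slots K T f"
  unfolding sum_slots_def using assms by (intro sum_pos) auto

lemma sum_slots_remove:
  assumes "k \<in> {1..K}"
  shows "sum_slots K T f = (\<Sum>t\<in>{1..T}. f k t) + (\<Sum>j\<in>{1..K} - {k}. \<Sum>t\<in>{1..T}. f j t)"
  unfolding sum_slots_def using assms by (intro sum.remove) auto

lemma sum_slots_diff_two:
  assumes "i \<in> {1..K}" "s \<in> {1..T}" "j \<in> {1..K}" "h \<in> {1..T}" "(i, s) \<noteq> (j, h)"
    and "\<And>k t. (k, t) \<noteq> (i, s) \<Longrightarrow> (k, t) \<noteq> (j, h) \<Longrightarrow> f k t = g k t"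
  shows "sum_slots K T f - sum_slots K T g = (f i s - g i s) + (f j h - g j h)"
proof -
  have "sum_slots K T f - sum_slots K T g
      = (\<Sum>z\<in>{1..K} \<times> {1..T}. f (fst z) (snd z) - g (fst z) (snd z))"
    by (simp add: sum_slots_Times sum_subtractf)
  also have "\<dots> = (\<Sum>z\<in>{(i, s), (j, h)}. f (fst z) (snd z) - g (fst z) (snd z))"
  proof (rule sum.mono_neutral_right)
    show "\<forall>z\<in>{1..K} \<times> {1..T} - {(i, s), (j, h)}. f (fst z) (snd z) - g (fst z) (snd z) = 0"
      using assms(6) by (metis Diff_iff diff_self insertCI prod.collapse)
  qed (use assms(1-4) in auto)
  also have "\<dots> = (f i s - g i s) + (f j h - g j h)"
    using assms(5) by simp
  finally show ?thesis .
qed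

section \<open>Best responses of the consumers\<close>

lemma demand_star_spending:
  assumes "K \<ge> 1" "T \<ge> 1"
    and p: "\<And>k t. k \<in> {1..K} \<Longrightarrow> t \<in> {1..T} \<Longrightarrow> 0 < p k t"
  shows "sum_slots K T (\<lambda>k t. p k t * demand_star K T B p n k t) = B n"
proof -
  let ?c = "(B n + sum_slots K T p) / (real K * real T)"
  have "sum_slots K T (\<lambda>k t. p k t * demand_star K T B p n k t) = sum_slots K T (\<lambda>k t. ?c - p k t)"
  proof (rule sum_slots_cong)
    fix k t assume "k \<in> {1..K}" "t \<in> {1..T}"
    then have "p k t \<noteq> 0" using p by fastforce
    then show "p k t * demand_star K T B p n k t = ?c - p k t"
      by (simp add: demand_star_def right_diff_distrib)
  qed
  also have "\<dots> = B n"
    using assms by (simp add: sum_slots_diff sum_slots_const)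
  finally show ?thesis .
qed

text \<open>
  The first-order bound \<open>ln (1 + y) \<le> ln (1 + x) + (y - x) / (1 + x)\<close> at \<open>x = demand_star\<close> has
  slope proportional to the price, so that summing it over the slots compares total expenditures,
  and \<open>x\<close> already exhausts the budget.
\<close>

lemma demand_star_optimal:
  assumes "K \<ge> 1" "T \<ge> 1"
    and p: "\<And>k t. k \<in> {1..K} \<Longrightarrow> t \<in> {1..T} \<Longrightarrow> 0 < p k t"
    and M: "0 < B n + sum_slots K T p"
    and nonneg: "\<And>k t. k \<in> {1..K} \<Longrightarrow> t \<in> {1..T} \<Longrightarrow> 0 \<le> demand_star K T B p n k t"
    and energy: "e \<le> sum_slots K T (demand_star K T B p n)"
  shows "consumer_optimal K T (B n) e p (demand_star K T B p n)"
proof -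
  let ?x = "demand_star K T B p n"
  let ?c = "real K * real T / (B n + sum_slots K T p)"
  have c: "0 < ?c" using assms(1,2) M by simp
  have spend: "sum_slots K T (\<lambda>k t. p k t * ?x k t) = B n"
    using demand_star_spending[of K T p B n] assms(1,2) p by blast
  have "utility K T y \<le> utility K T ?x" if y: "consumer_feasible K T (B n) e p y" for y
  proof -
    have "utility K T y \<le> sum_slots K T (\<lambda>k t. ln (1 + ?x k t) + ?c * (p k t * y k t - p k t * ?x k t))"
      unfolding utility_def
    proof (rule sum_slots_mono)
      fix k t assume kt: "k \<in> {1..K}" "t \<in> {1..T}"
      have x0: "0 \<le> ?x k t" using nonneg kt by blast
      have y0: "0 \<le> y k t" using y kt by (simp add: consumer_feasible_def)
      have slope: "1 / (1 + ?x k t) = ?c * p k t"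
        by (simp add: demand_star_def)
      have "ln (1 + y k t) - ln (1 + ?x k t) = ln ((1 + y k t) / (1 + ?x k t))"
        using x0 y0 by (simp add: ln_div)
      also have "\<dots> \<le> (1 + y k t) / (1 + ?x k t) - 1"
        using x0 y0 by (intro ln_le_minus_one) simp
      also have "\<dots> = (1 / (1 + ?x k t)) * (y k t - ?x k t)"
        using x0 by (simp add: field_simps)
      also have "\<dots> = ?c * (p k t * y k t - p k t * ?x k t)"
        unfolding slope by (simp only: algebra_simps)
      finally show "ln (1 + y k t) \<le> ln (1 + ?x k t) + ?c * (p k t * y k t - p k t * ?x k t)"
        by linarith
    qed
    also have "\<dots> = utility K T ?x + ?c * (sum_slots K T (\<lambda>k t. p k t * y k t) - B n)"
      by (simp only: sum_slots_add sum_slots_mult sum_slots_diff spend utility_def)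
    also have "\<dots> \<le> utility K T ?x"
    proof -
      have "sum_slots K T (\<lambda>k t. p k t * y k t) - B n \<le> 0"
        using y by (simp add: consumer_feasible_def)
      then have "?c * (sum_slots K T (\<lambda>k t. p k t * y k t) - B n) \<le> 0"
        using c by (intro mult_nonneg_nonpos) auto
      then show ?thesis by linarith
    qed
    finally show ?thesis .
  qed
  then show ?thesis
    using nonneg energy spend by (simp add: consumer_optimal_def consumer_feasible_def)
qed

text \<open>
  Every \<open>1 + demand_star\<close> is \<open>(B n + \<Sum>p) / (K T p)\<close>, so that multiplying the budget bound by
  \<open>\<Sum> 1 / (K T p)\<close> turns it into a bound on the total demand.
\<close>

lemma demand_star_energy:
  assumes "K \<ge> 1" "T \<ge> 1"
    and p: "\<And>k t. k \<in> {1..K} \<Longrightarrow> t \<in> {1..T} \<Longrightarrow> 0 < p k t"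
    and budget: "B n \<ge> (e + real K * real T) / sum_slots K T (\<lambda>k t. 1 / (real K * real T * p k t))
                  - sum_slots K T p"
  shows "e \<le> sum_slots K T (demand_star K T B p n)"
proof -
  let ?R = "sum_slots K T (\<lambda>k t. 1 / (real K * real T * p k t))"
  let ?M = "B n + sum_slots K T p"
  have R: "0 < ?R" using assms(1,2) p by (intro sum_slots_pos) auto
  have "(e + real K * real T) / ?R \<le> ?M" using budget by linarith
  then have "e + real K * real T \<le> ?M * ?R" using R by (simp add: pos_divide_le_eq)
  also have "?M * ?R = sum_slots K T (\<lambda>k t. ?M * (1 / (real K * real T * p k t)))"
    by (simp only: sum_slots_mult)
  also have "\<dots> = sum_slots K T (\<lambda>k t. demand_star K T B p n k t + 1)"
    by (simp add: demand_star_def)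
  also have "\<dots> = sum_slots K T (demand_star K T B p n) + real K * real T"
    by (simp add: sum_slots_add sum_slots_const)
  finally show ?thesis by simp
qed

text \<open>
  Exchanging the expenditures \<open>u > v\<close> of a dear slot and a cheap slot keeps the budget, and it
  raises both the energy obtained and the product \<open>(1 + x)(1 + x')\<close> of the two slots by
  \<open>(u - v)(1 / p' - 1 / p) > 0\<close>, where \<open>p > p'\<close> are the prices.
  The energy constraint survives the exchange, so the argument holds whether or not it binds.
\<close>

lemma optimal_spending_antimono:
  assumes opt: "consumer_optimal K T b e p x"
    and ia: "i \<in> {1..K}" "s \<in> {1..T}" and jh: "j \<in> {1..K}" "h \<in> {1..T}"
    and price: "0 < p j h" "p j h < p i s"
  shows "p i s * x i s \<le> p j h * x j h"
proof (rule ccontr)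
  assume neg: "\<not> p i s * x i s \<le> p j h * x j h"
  define u v where "u = p i s * x i s" and "v = p j h * x j h"
  have uv: "v < u" using neg by (simp add: u_def v_def)
  define y where
    "y = (\<lambda>k t. if (k, t) = (i, s) then v / p i s else if (k, t) = (j, h) then u / p j h else x k t)"
  have ne: "(i, s) \<noteq> (j, h)" using price by auto
  have yi: "y i s = v / p i s" and yj: "y j h = u / p j h"
    and yo: "\<And>k t. (k, t) \<noteq> (i, s) \<Longrightarrow> (k, t) \<noteq> (j, h) \<Longrightarrow> y k t = x k t"
    using ne by (auto simp: y_def)
  have p_pos: "0 < p i s" using price by linarith
  have xi: "x i s = u / p i s" and xj: "x j h = v / p j h"
    using p_pos price by (simp_all add: u_def v_def)
  have x_nonneg: "\<And>k t. k \<in> {1..K} \<Longrightarrow> t \<in> {1..T} \<Longrightarrow> 0 \<le> x k t"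
    using opt by (simp add: consumer_optimal_def consumer_feasible_def)
  have v0: "0 \<le> v" using x_nonneg[OF jh] price by (simp add: v_def)
  have u0: "0 < u" using v0 uv by linarith
  have gain: "0 < (u - v) * (1 / p j h - 1 / p i s)"
    using uv price p_pos by (intro mult_pos_pos) (simp_all add: frac_less2)
  have spending: "sum_slots K T (\<lambda>k t. p k t * y k t) - sum_slots K T (\<lambda>k t. p k t * x k t) = 0"
    by (subst sum_slots_diff_two[OF ia jh ne])
       (use yo p_pos price in \<open>simp_all add: yi yj xi xj\<close>)
  have "sum_slots K T y - sum_slots K T x = (y i s - x i s) + (y j h - x j h)"
    by (rule sum_slots_diff_two[OF ia jh ne]) (use yo in simp)
  also have "\<dots> = (u - v) * (1 / p j h - 1 / p i s)"
    unfolding yi yj xi xj using p_pos price by (simp add: field_simps)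
  finally have energy: "sum_slots K T x \<le> sum_slots K T y" using gain by linarith
  have y_nonneg: "\<forall>k\<in>{1..K}. \<forall>t\<in>{1..T}. 0 \<le> y k t"
    using x_nonneg u0 v0 p_pos price by (auto simp: y_def)
  have "consumer_feasible K T b e p y"
    using opt spending energy y_nonneg
    by (simp add: consumer_optimal_def consumer_feasible_def)
  then have le: "utility K T y \<le> utility K T x"
    using opt by (simp add: consumer_optimal_def)
  have "utility K T y - utility K T x
      = (ln (1 + y i s) - ln (1 + x i s)) + (ln (1 + y j h) - ln (1 + x j h))"
    unfolding utility_def
    by (rule sum_slots_diff_two[OF ia jh ne]) (use yo in simp)
  also have "\<dots> = ln ((1 + y i s) * (1 + y j h)) - ln ((1 + x i s) * (1 + x j h))"
  proof -
    have "0 < 1 + x i s" "0 < 1 + x j h" "0 < 1 + y i s" "0 < 1 + y j h"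
      using x_nonneg y_nonneg ia jh by (simp_all add: add_pos_nonneg)
    then show ?thesis by (simp add: ln_mult)
  qed
  finally have diff: "utility K T y - utility K T x
      = ln ((1 + y i s) * (1 + y j h)) - ln ((1 + x i s) * (1 + x j h))" .
  have "(1 + y i s) * (1 + y j h) - (1 + x i s) * (1 + x j h)
      = (u - v) * (1 / p j h - 1 / p i s)"
    unfolding yi yj xi xj by (simp add: algebra_simps diff_divide_distrib)
  then have "(1 + x i s) * (1 + x j h) < (1 + y i s) * (1 + y j h)"
    using gain by linarith
  moreover have "0 < (1 + x i s) * (1 + x j h)"
    using x_nonneg[OF ia] x_nonneg[OF jh] by (simp add: add_pos_nonneg)
  ultimately have "ln ((1 + x i s) * (1 + x j h)) < ln ((1 + y i s) * (1 + y j h))"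
    by simp
  then show False using le diff by linarith
qed

section \<open>Price deviations of a company\<close>

text \<open>
  The two bounds on company \<open>k\<close>'s revenue that are played off against each other: slot by slot
  (capacity for cheap slots, the exchange argument for dear ones), and by what the budgets leave
  after the purchases from the other companies.
\<close>

lemma price_deviation_revenue_le:
  fixes P g b :: real
  assumes k: "k \<in> {1..K}"
    and P: "0 < P" and others: "\<And>j t. j \<in> {1..K} - {k} \<Longrightarrow> t \<in> {1..T} \<Longrightarrow> p j t = P"
    and own: "\<And>t. t \<in> {1..T} \<Longrightarrow> 0 < p k t"
    and opt: "\<And>n. n \<in> {1..N} \<Longrightarrow> consumer_optimal K T b (E n) p (d n)"
    and cap: "\<And>t. t \<in> {1..T} \<Longrightarrow> (\<Sum>n\<in>{1..N}. d n k t) \<le> g"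
    and budget: "real N * b = real K * real T * P * g"
  shows "revenue T N p d k \<le> real T * P * g"
proof -
  define D where "D j t = (\<Sum>n\<in>{1..N}. d n j t)" for j t
  define Z where "Z = (\<Sum>j\<in>{1..K} - {k}. \<Sum>t\<in>{1..T}. D j t)"
  have cardS: "real (card ({1..K} - {k})) = real K - 1"
    using k by (simp add: of_nat_diff)
  have dear: "p k t * D k t \<le> P * D j h"
    if "t \<in> {1..T}" "j \<in> {1..K} - {k}" "h \<in> {1..T}" "P < p k t" for t j h
  proof -
    have "p k t * d n k t \<le> P * d n j h" if "n \<in> {1..N}" for n
      using optimal_spending_antimono[OF opt[OF that] k \<open>t \<in> {1..T}\<close>, of j h]
        others[of j h] \<open>j \<in> {1..K} - {k}\<close> \<open>h \<in> {1..T}\<close> \<open>P < p k t\<close> P by simp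
    then show ?thesis unfolding D_def sum_distrib_left by (intro sum_mono) auto
  qed
  \<comment> \<open>Adding up the budget constraints of all consumers.\<close>
  have total: "revenue T N p d k + P * Z \<le> real N * b"
  proof -
    have "(\<Sum>n\<in>{1..N}. sum_slots K T (\<lambda>j t. p j t * d n j t)) \<le> (\<Sum>n\<in>{1..N}. b)"
      using opt by (intro sum_mono) (simp add: consumer_optimal_def consumer_feasible_def)
    moreover have "(\<Sum>n\<in>{1..N}. sum_slots K T (\<lambda>j t. p j t * d n j t))
        = sum_slots K T (\<lambda>j t. p j t * D j t)"
      unfolding sum_slots_Times D_def sum_distrib_left by (rule sum.swap)
    moreover have "sum_slots K T (\<lambda>j t. p j t * D j t) = revenue T N p d k + P * Z"
    proof -
      have "(\<Sum>j\<in>{1..K} - {k}. \<Sum>t\<in>{1..T}. p j t * D j t) = P * Z"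
        unfolding Z_def sum_distrib_left by (intro sum.cong refl) (simp add: others)
      then show ?thesis
        by (simp add: sum_slots_remove[OF k] revenue_def D_def)
    qed
    ultimately show ?thesis by simp
  qed
  show ?thesis
  proof (cases "(real K - 1) * real T * g \<le> Z")
    case True
    then have "P * ((real K - 1) * real T * g) \<le> P * Z" using P by simp
    then show ?thesis using total budget by (simp add: algebra_simps)
  next
    case False
    \<comment> \<open>Some slot of another company has total demand at most \<open>g\<close>; the exchange argument
      compares every dear slot of company \<open>k\<close> with this one.\<close>
    obtain j h where jh: "j \<in> {1..K} - {k}" "h \<in> {1..T}" "D j h \<le> g"
    proof (rule ccontr)
      assume "\<not> thesis"
      then have "\<And>j h. j \<in> {1..K} - {k} \<Longrightarrow> h \<in> {1..T} \<Longrightarrow> g \<le> D j h"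
        using that by force
      then have "(\<Sum>j\<in>{1..K} - {k}. \<Sum>h\<in>{1..T}. g) \<le> Z"
        unfolding Z_def by (intro sum_mono) auto
      moreover have "(\<Sum>j\<in>{1..K} - {k}. \<Sum>h\<in>{1..T}. g) = (real K - 1) * real T * g"
        by (simp only: sum_constant cardS card_atLeastAtMost diff_Suc_1 mult.assoc)
      ultimately show False using False by metis
    qed
    have "p k t * D k t \<le> P * g" if t: "t \<in> {1..T}" for t
    proof (cases "P < p k t")
      case True
      have "p k t * D k t \<le> P * D j h" by (rule dear[OF t jh(1,2) True])
      also have "\<dots> \<le> P * g" using jh(3) P by simp
      finally show ?thesis .
    next
      case False
      have "0 \<le> d n k t" if "n \<in> {1..N}" for n
        using opt[OF that] k t by (simp add: consumer_optimal_def consumer_feasible_def)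
      then have "0 \<le> D k t" unfolding D_def by (intro sum_nonneg) auto
      then show ?thesis
        using False P cap[OF t] by (intro mult_mono) (auto simp: D_def)
    qed
    then have "revenue T N p d k \<le> (\<Sum>t\<in>{1..T}. P * g)"
      unfolding revenue_def D_def by (intro sum_mono) auto
    then show ?thesis by (simp add: mult.assoc)
  qed
qed

section \<open>The power allocation game\<close>

text \<open>
  The complement of the terms \<open>N / (G + N)\<close> of the price formula: over all companies the weights
  add up to the denominator \<open>K T - \<Sum> N / (G + N)\<close>.
\<close>

definition market_weight :: "nat \<Rightarrow> nat \<Rightarrow> (nat \<Rightarrow> real) \<Rightarrow> real" where
  "market_weight T N g = (\<Sum>t\<in>{1..T}. g t / (g t + real N))"

lemma market_weight_nonneg:
  assumes "\<forall>t\<in>{1..T}. 0 \<le> g t"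
  shows "0 \<le> market_weight T N g"
  unfolding market_weight_def using assms by (intro sum_nonneg) simp

lemma market_weight_complement:
  assumes "N \<ge> 1" "\<forall>t\<in>{1..T}. 0 \<le> g t"
  shows "(\<Sum>t\<in>{1..T}. real N / (g t + real N)) = real T - market_weight T N g"
proof -
  have "(\<Sum>t\<in>{1..T}. real N / (g t + real N)) = (\<Sum>t\<in>{1..T}. 1 - g t / (g t + real N))"
  proof (rule sum.cong[OF refl])
    fix t assume "t \<in> {1..T}"
    then have "g t + real N > 0" using assms by (simp add: add_nonneg_pos)
    then show "real N / (g t + real N) = 1 - g t / (g t + real N)" by (simp add: field_simps)
  qed
  then show ?thesis by (simp add: market_weight_def sum_subtractf)
qed

text \<open>
  A company collects \<open>T\<close> of the \<open>K T\<close> equal instalments of \<open>\<Sum>B + N \<Sum>p\<close>, less \<open>N\<close> times its own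
  prices; in terms of weights both parts are multiples of \<open>\<Sum>B\<close> over the total weight.  When
  nobody offers power, both sides are \<open>0\<close> by division by zero.
\<close>

lemma allocation_payoff_share:
  assumes "K \<ge> 1" "N \<ge> 1" "T \<ge> 1" and k: "k \<in> {1..K}"
    and G: "\<forall>j\<in>{1..K}. \<forall>t\<in>{1..T}. 0 \<le> G j t"
    and B: "0 < (\<Sum>n\<in>{1..N}. B n)"
  shows "allocation_payoff K T N B G k
       = (\<Sum>n\<in>{1..N}. B n) * (market_weight T N (G k) / (\<Sum>j\<in>{1..K}. market_weight T N (G j)))"
proof -
  define D where "D = (\<Sum>j\<in>{1..K}. market_weight T N (G j))"
  define \<beta> where "\<beta> = (\<Sum>n\<in>{1..N}. B n)"
  define p where "p = price_star K T N B G"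
  have compl: "(\<Sum>t\<in>{1..T}. real N / (G j t + real N)) = real T - market_weight T N (G j)"
    if "j \<in> {1..K}" for j
    using market_weight_complement[of N T "G j"] assms(2) G that by blast
  have W: "sum_slots K T (\<lambda>j h. real N / (G j h + real N)) = real K * real T - D"
  proof -
    have "sum_slots K T (\<lambda>j h. real N / (G j h + real N))
        = (\<Sum>j\<in>{1..K}. real T - market_weight T N (G j))"
      unfolding sum_slots_def by (intro sum.cong refl compl)
    then show ?thesis by (simp add: D_def sum_subtractf)
  qed
  have p_eq: "p j t = \<beta> / (real N * D) * (real N / (G j t + real N))" for j t
    using \<open>N \<ge> 1\<close> by (simp add: p_def price_star_def W \<beta>_def)
  have payoff: "allocation_payoff K T N B G k = revenue T N p (demand_star K T B p) k"
    by (simp add: allocation_payoff_def p_def)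
  show ?thesis
  proof (cases "D = 0")
    case True
    then show ?thesis by (simp add: payoff revenue_def p_eq D_def)
  next
    case False
    have "0 \<le> D" unfolding D_def using G by (intro sum_nonneg market_weight_nonneg) auto
    then have D: "0 < D" using False by simp
    let ?KT = "real K * real T"
    have KT: "0 < ?KT" using assms(1,3) by simp
    have own: "(\<Sum>t\<in>{1..T}. p k t) = \<beta> / (real N * D) * (real T - market_weight T N (G k))"
      by (simp only: p_eq sum_distrib_left[symmetric] compl[OF k])
    have all: "sum_slots K T p = \<beta> / (real N * D) * (?KT - D)"
    proof -
      have "sum_slots K T p = sum_slots K T (\<lambda>j t. \<beta> / (real N * D) * (real N / (G j t + real N)))"
        by (intro sum_slots_cong p_eq)
      then show ?thesis by (simp only: sum_slots_mult W)
    qed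
    have "p k t * (\<Sum>n\<in>{1..N}. demand_star K T B p n k t)
        = (\<beta> + real N * sum_slots K T p) / ?KT - real N * p k t" if t: "t \<in> {1..T}" for t
    proof -
      have "0 < G k t + real N" using G k t \<open>N \<ge> 1\<close> by (simp add: add_nonneg_pos)
      then have p0: "p k t \<noteq> 0"
        using B D \<open>N \<ge> 1\<close> by (simp add: p_eq \<beta>_def)
      have "(\<Sum>n\<in>{1..N}. demand_star K T B p n k t)
          = (\<beta> + real N * sum_slots K T p) / (?KT * p k t) - real N"
        by (simp add: demand_star_def sum_subtractf sum.distrib \<beta>_def flip: sum_divide_distrib)
      then show ?thesis using p0 by (simp add: right_diff_distrib)
    qed
    then have "allocation_payoff K T N B G k
        = (\<Sum>t\<in>{1..T}. (\<beta> + real N * sum_slots K T p) / ?KT - real N * p k t)"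
      unfolding payoff revenue_def by (rule sum.cong[OF refl])
    also have "\<dots> = real T * ((\<beta> + real N * sum_slots K T p) / ?KT) - real N * (\<Sum>t\<in>{1..T}. p k t)"
      by (simp add: sum_subtractf sum_distrib_left)
    also have "\<beta> + real N * sum_slots K T p = \<beta> * ?KT / D"
      using \<open>N \<ge> 1\<close> D by (simp add: all field_simps)
    also have "real T * (\<beta> * ?KT / D / ?KT) - real N * (\<Sum>t\<in>{1..T}. p k t)
        = \<beta> * (market_weight T N (G k) / D)"
      using assms(1-3) D unfolding own by (simp add: field_simps)
    finally show ?thesis by (simp add: \<beta>_def D_def)
  qed
qed

text \<open>
  Concavity of \<open>x / (x + N)\<close>, used through its tangent at the equal share; the linear terms add up
  to at most zero.
\<close>

lemma market_weight_le_equal_split: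
  assumes "N \<ge> 1" "T \<ge> 1" and gtot: "0 < gtot" and feas: "allocation_feasible T gtot g"
  shows "market_weight T N g \<le> market_weight T N (\<lambda>t. gtot / real T)"
proof -
  define a where "a = gtot / real T"
  have a: "0 < a" using gtot assms(2) by (simp add: a_def)
  define s where "s = real N / (a + real N)^2"
  have s: "0 \<le> s" by (simp add: s_def)
  have "market_weight T N g \<le> (\<Sum>t\<in>{1..T}. a / (a + real N) + s * (g t - a))"
    unfolding market_weight_def
  proof (rule sum_mono)
    fix t assume "t \<in> {1..T}"
    then have x: "0 \<le> g t" using feas by (simp add: allocation_feasible_def)
    have pos: "0 < g t + real N" "0 < a + real N" using x a \<open>N \<ge> 1\<close> by auto
    have "a / (a + real N) + s * (g t - a) - g t / (g t + real N)
        = real N * (g t - a)^2 / ((a + real N)^2 * (g t + real N))"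
      unfolding s_def using pos by (simp add: divide_simps power2_eq_square) algebra
    also have "\<dots> \<ge> 0" using pos by simp
    finally show "g t / (g t + real N) \<le> a / (a + real N) + s * (g t - a)" by linarith
  qed
  also have "\<dots> = market_weight T N (\<lambda>t. a) + s * ((\<Sum>t\<in>{1..T}. g t) - gtot)"
    using assms(2)
    by (simp add: market_weight_def sum.distrib sum_subtractf a_def flip: sum_distrib_left)
  also have "\<dots> \<le> market_weight T N (\<lambda>t. a)"
    using feas s by (simp add: allocation_feasible_def mult_le_0_iff)
  finally show ?thesis by (simp add: a_def)
qed

lemma share_mono:
  fixes x y c :: real
  assumes "0 \<le> x" "x \<le> y" "0 \<le> c" "0 < y"
  shows "x / (x + c) \<le> y / (y + c)"
proof (cases "x = 0")
  case True
  then show ?thesis using assms by simp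
next
  case False
  have "x * c \<le> y * c" using assms by (intro mult_right_mono)
  then show ?thesis using assms False by (simp add: divide_simps algebra_simps)
qed

lemma equal_split_nash:
  assumes "K \<ge> 1" "N \<ge> 1" "T \<ge> 1"
    and Gtot: "\<forall>k\<in>{1..K}. Gtot k > 0" and B: "\<forall>n\<in>{1..N}. B n > 0"
  shows "power_allocation_nash K T N B Gtot (\<lambda>k t. Gtot k / real T)"
proof -
  let ?G = "\<lambda>k t. Gtot k / real T"
  have feas: "\<forall>k\<in>{1..K}. allocation_feasible T (Gtot k) (?G k)"
    using Gtot \<open>T \<ge> 1\<close> by (simp add: allocation_feasible_def less_imp_le)
  have G0: "\<forall>j\<in>{1..K}. \<forall>t\<in>{1..T}. 0 \<le> ?G j t"
    using feas by (simp add: allocation_feasible_def)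
  have Bsum: "0 < (\<Sum>n\<in>{1..N}. B n)" using B \<open>N \<ge> 1\<close> by (intro sum_pos) auto
  have "allocation_payoff K T N B (?G(k := g)) k \<le> allocation_payoff K T N B ?G k"
    if k: "k \<in> {1..K}" and g: "allocation_feasible T (Gtot k) g" for k g
  proof -
    let ?H = "?G(k := g)"
    let ?w = "market_weight T N"
    define c where "c = (\<Sum>j\<in>{1..K} - {k}. ?w (?G j))"
    have g0: "\<forall>t\<in>{1..T}. 0 \<le> g t" using g by (simp add: allocation_feasible_def)
    have H0: "\<forall>j\<in>{1..K}. \<forall>t\<in>{1..T}. 0 \<le> ?H j t" using G0 g0 by simp
    have sumG: "(\<Sum>j\<in>{1..K}. ?w (?G j)) = ?w (?G k) + c"
      unfolding c_def using k by (intro sum.remove) auto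
    have sumH: "(\<Sum>j\<in>{1..K}. ?w (?H j)) = ?w g + c"
    proof -
      have "(\<Sum>j\<in>{1..K}. ?w (?H j)) = ?w (?H k) + (\<Sum>j\<in>{1..K} - {k}. ?w (?H j))"
        using k by (intro sum.remove) auto
      also have "(\<Sum>j\<in>{1..K} - {k}. ?w (?H j)) = c"
        unfolding c_def by (intro sum.cong) auto
      finally show ?thesis by simp
    qed
    have "0 \<le> c" unfolding c_def using G0 by (intro sum_nonneg market_weight_nonneg) auto
    moreover have "0 < ?w (?G k)"
    proof -
      have "0 < Gtot k / real T" using Gtot k \<open>T \<ge> 1\<close> by simp
      then show ?thesis
        unfolding market_weight_def using \<open>T \<ge> 1\<close>
        by (intro sum_pos divide_pos_pos[of "Gtot k / real T"] add_pos_nonneg) auto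
    qed
    moreover have "?w g \<le> ?w (?G k)"
      using market_weight_le_equal_split[OF \<open>N \<ge> 1\<close> \<open>T \<ge> 1\<close> _ g] Gtot k by simp
    ultimately have "?w g / (?w g + c) \<le> ?w (?G k) / (?w (?G k) + c)"
      using market_weight_nonneg[OF g0] by (intro share_mono) auto
    moreover have "allocation_payoff K T N B ?H k = (\<Sum>n\<in>{1..N}. B n) * (?w g / (?w g + c))"
      using allocation_payoff_share[of K N T k ?H B] assms(1-3) k H0 Bsum sumH
      by (simp del: fun_upd_apply add: fun_upd_same)
    moreover have "allocation_payoff K T N B ?G k
        = (\<Sum>n\<in>{1..N}. B n) * (?w (?G k) / (?w (?G k) + c))"
      using allocation_payoff_share[of K N T k ?G B] assms(1-3) k G0 Bsum sumG by simp
    ultimately show ?thesis using Bsum by (metis less_imp_le mult_left_mono)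
  qed
  then show ?thesis using feas by (simp add: power_allocation_nash_def)
qed

section \<open>The symmetric equilibrium\<close>

lemma price_star_symmetric:
  assumes "K \<ge> 1" "N \<ge> 1" "T \<ge> 1" "0 < g"
    and G: "\<And>k t. k \<in> {1..K} \<Longrightarrow> t \<in> {1..T} \<Longrightarrow> G k t = g"
    and kt: "k \<in> {1..K}" "t \<in> {1..T}"
  shows "price_star K T N B G k t = (\<Sum>n\<in>{1..N}. B n) / (real K * real T * g)"
proof -
  have "sum_slots K T (\<lambda>j h. real N / (G j h + real N)) = sum_slots K T (\<lambda>j h. real N / (g + real N))"
    by (rule sum_slots_cong) (simp add: G)
  also have "\<dots> = real K * real T * (real N / (g + real N))"
    by (rule sum_slots_const)
  finally have "real K * real T - sum_slots K T (\<lambda>j h. real N / (G j h + real N))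
      = real K * real T * g / (g + real N)"
    using assms(1-4) by (simp add: field_simps)
  then show ?thesis
    using assms(2,4) by (simp add: price_star_def G[OF kt])
qed

theorem theorem5:
  fixes K N T :: nat
    and B E Gtot :: "nat \<Rightarrow> real"
    and pmax :: real
    and G p :: "nat \<Rightarrow> nat \<Rightarrow> real"
    and d :: "nat \<Rightarrow> nat \<Rightarrow> nat \<Rightarrow> real"
  assumes "K \<ge> 1" and "N \<ge> 1" and "T \<ge> 1"
    and pmax_pos: "pmax > 0"
    and E_nonneg: "\<forall>n\<in>{1..N}. E n \<ge> 0"
    and G_def: "G = (\<lambda>k t. Gtot k / real T)"
    and p_def: "p = price_star K T N B G"
    and d_def: "d = demand_star K T B p"
    and budget_lower: "\<forall>n\<in>{1..N}. B n \<ge>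
          (E n + real K * real T) / sum_slots K T (\<lambda>k t. 1 / (real K * real T * p k t))
          - sum_slots K T p"
    and Gtot_pos: "\<forall>k\<in>{1..K}. Gtot k > 0"
    and Gtot_same: "\<forall>j\<in>{1..K}. \<forall>k\<in>{1..K}. Gtot j = Gtot k"
    and B_pos: "\<forall>n\<in>{1..N}. B n > 0"
    and B_same: "\<forall>m\<in>{1..N}. \<forall>n\<in>{1..N}. B m = B n"
  shows "power_allocation_nash K T N B Gtot G \<and>
         stackelberg_equilibrium K T N B E G p d \<and>
         (\<forall>n\<in>{1..N}. \<forall>k\<in>{1..K}. \<forall>t\<in>{1..T}.
            (p k t \<le> pmax \<and> (\<Sum>j\<in>{1..K}. revenue T N p d j) = (\<Sum>m\<in>{1..N}. B m))
            \<longleftrightarrow> real K / real N \<ge> B n / (pmax * real T * G k t))"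
proof -
  define g where "g = Gtot 1 / real T"
  define b where "b = B 1"
  define P where "P = real N * b / (real K * real T * g)"
  have pos: "0 < real K" "0 < real N" "0 < real T" using assms(1-3) by auto
  have g: "0 < g" using Gtot_pos assms(1) pos by (simp add: g_def)
  have b: "0 < b" using B_pos assms(2) by (simp add: b_def)
  have P: "0 < P" using pos g b by (simp add: P_def)
  have G: "G k t = g" if "k \<in> {1..K}" for k t
  proof -
    have "Gtot k = Gtot 1" using Gtot_same that assms(1) by (metis atLeastAtMost_iff order_refl)
    then show ?thesis by (simp add: G_def g_def)
  qed
  have B: "B n = b" if "n \<in> {1..N}" for n
    using B_same that assms(2) unfolding b_def by (metis atLeastAtMost_iff order_refl)
  have Bsum: "(\<Sum>n\<in>{1..N}. B n) = real N * b" by (simp add: B)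
  have price: "p k t = P" if "k \<in> {1..K}" "t \<in> {1..T}" for k t
    unfolding p_def P_def Bsum[symmetric]
    by (rule price_star_symmetric[OF assms(1-3) g]) (use G that in auto)
  have pricesum: "sum_slots K T p = real K * real T * P"
    using sum_slots_cong[of K T p "\<lambda>k t. P"] price by (simp add: sum_slots_const)
  have budget: "real N * b = real K * real T * P * g"
    using pos g by (simp add: P_def)
  have demand: "d n k t = g / real N" if "n \<in> {1..N}" "k \<in> {1..K}" "t \<in> {1..T}" for n k t
  proof -
    have "d n k t = b / (real K * real T * P)"
      using pos P by (simp add: d_def demand_star_def B[OF that(1)] price[OF that(2,3)] pricesum
          add_divide_distrib)
    also have "\<dots> = g / real N" using pos P budget by (simp add: field_simps)
    finally show ?thesis .
  qed
  have sold: "(\<Sum>n\<in>{1..N}. d n k t) = g" if "k \<in> {1..K}" "t \<in> {1..T}" for k t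
  proof -
    have "(\<Sum>n\<in>{1..N}. d n k t) = (\<Sum>n\<in>{1..N}. g / real N)"
      by (intro sum.cong refl demand that)
    then show ?thesis using pos by simp
  qed
  have rev: "revenue T N p d k = real T * P * g" if "k \<in> {1..K}" for k
  proof -
    have "revenue T N p d k = (\<Sum>t\<in>{1..T}. P * g)"
      unfolding revenue_def by (intro sum.cong refl) (simp only: sold price that)
    then show ?thesis by (simp add: mult.assoc)
  qed
  have revsum: "(\<Sum>j\<in>{1..K}. revenue T N p d j) = (\<Sum>m\<in>{1..N}. B m)"
  proof -
    have "(\<Sum>j\<in>{1..K}. revenue T N p d j) = (\<Sum>j\<in>{1..K}. real T * P * g)"
      by (intro sum.cong refl rev)
    also have "\<dots> = (\<Sum>m\<in>{1..N}. B m)" unfolding Bsum budget by simp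
    finally show ?thesis .
  qed
  have "stackelberg_equilibrium K T N B E G p d"
    unfolding stackelberg_equilibrium_def
  proof (intro conjI ballI allI impI)
    fix n assume n: "n \<in> {1..N}"
    show "consumer_optimal K T (B n) (E n) p (d n)"
      unfolding d_def
    proof (rule demand_star_optimal[OF assms(1,3)])
      show "0 < p k t" if "k \<in> {1..K}" "t \<in> {1..T}" for k t using price that P by simp
      then show "E n \<le> sum_slots K T (demand_star K T B p n)"
        using demand_star_energy[OF assms(1,3)] budget_lower n by blast
      show "0 < B n + sum_slots K T p" using b P pos by (simp add: B[OF n] pricesum add_pos_nonneg)
      show "0 \<le> demand_star K T B p n k t" if "k \<in> {1..K}" "t \<in> {1..T}" for k t
        using demand[OF n that] g by (simp add: d_def)
    qed
  next
    fix k assume "k \<in> {1..K}"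
    then show "company_feasible T N G p d k"
      using P price sold G unfolding company_feasible_def by (metis order_refl)
  next
    fix k q d'
    assume k: "k \<in> {1..K}"
      and dev: "(\<forall>n\<in>{1..N}. consumer_optimal K T (B n) (E n) (p(k := q)) (d' n)) \<and>
        company_feasible T N G (p(k := q)) d' k"
    have "revenue T N (p(k := q)) d' k \<le> real T * P * g"
    proof (rule price_deviation_revenue_le[OF k P])
      show "real N * b = real K * real T * P * g" by (rule budget)
    next
      fix n assume "n \<in> {1..N}"
      then show "consumer_optimal K T b (E n) (p(k := q)) (d' n)" using dev B by metis
    qed (use dev k price G in \<open>auto simp: company_feasible_def\<close>)
    then show "revenue T N (p(k := q)) d' k \<le> revenue T N p d k" by (simp add: rev[OF k])
  qed
  moreover have "power_allocation_nash K T N B Gtot G"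
    unfolding G_def by (rule equal_split_nash[OF assms(1-3) Gtot_pos B_pos])
  moreover have "(p k t \<le> pmax \<and> (\<Sum>j\<in>{1..K}. revenue T N p d j) = (\<Sum>m\<in>{1..N}. B m))
      \<longleftrightarrow> real K / real N \<ge> B n / (pmax * real T * G k t)"
    if "n \<in> {1..N}" "k \<in> {1..K}" "t \<in> {1..T}" for n k t
  proof -
    have "P \<le> pmax \<longleftrightarrow> real K / real N \<ge> b / (pmax * real T * g)"
      using pos g pmax_pos by (simp add: P_def field_simps)
    then show ?thesis
      by (simp only: revsum price[OF that(2,3)] B[OF that(1)] G[OF that(2)] simp_thms)
  qed
  ultimately show ?thesis by blast
qed

end
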